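(* Let $n,k,s$ be positive integers and $K=s(n-1)+k$. If $k>s+1$, then the polytope $P_{n,k,s}\subseteq\mathbb{R}^{K}$ (coordinates $x_0,\ldots,x_{K-1}$) is given by the following minimal inequality description: $$\sum_{i=0}^{K-1}x_i=n,$$ $$\sum_{i\notin\lambda_0\cup\cdots\cup\lambda_r}x_i\le n-1-r\quad\text{for each } r\in\{0,\ldots,n-2\},$$ $$\sum_{i\notin\lambda_r\cup\cdots\cup\lambda_{n-1}}x_i\le r\quad\text{for each } r\in\{1,\ldots,n-1\},$$ $$\sum_{i\ne a}x_i\le n\quad\text{for each } a\in\{0,\ldots,K-1\}.$$ If $k=s+1$, then $P_{n,k,s}$ is given by the same minimal description, except that the inequalities of the last type are only taken for those $a\in\{0,\ldots,K-1\}$ for which there is no $r\in\{1,\ldots,n-1\}$ with $a=r(k-1)$.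
   Context: Let $e_0,\ldots,e_{K-1}$ be the standard basis of $\mathbb{R}^{K}$. For $0\le i\le n-1$ let $\lambda_i=\{si,si+1,\ldots,si+k-1\}$ and $\Delta_{\lambda_i}=\operatorname{conv}\{e_j: j\in\lambda_i\}$. Then $P_{n,k,s}=\sum_{i=0}^{n-1}\Delta_{\lambda_i}$ (Minkowski sum). All index sets in the sums are subsets of $\{0,\ldots,K-1\}$. "Minimal inequality description" means that the equation describes the affine hull of $P_{n,k,s}$, the polytope is the solution set of the listed equation and inequalities, and the inequalities are in bijection with the facets (none is redundant). *)

theory Defs
  imports "HOL-Analysis.Analysis"
begin

(* R^K is rendered as real ^ 'm; idx enumerates the coordinate type 'm by 0, ..., K - 1,
   so that x_j is  x $ idx j  and the standard basis vector e_j is  axis (idx j) 1. *)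

definition ambient_dim :: "nat \<Rightarrow> nat \<Rightarrow> nat \<Rightarrow> nat" where
  "ambient_dim n k s = s * (n - 1) + k"

definition lam :: "nat \<Rightarrow> nat \<Rightarrow> nat \<Rightarrow> nat set" where
  "lam k s i = {s * i ..< s * i + k}"

definition simplex_on :: "(nat \<Rightarrow> 'm::finite) \<Rightarrow> nat set \<Rightarrow> (real ^ 'm) set" where
  "simplex_on idx A = convex hull ((\<lambda>j. axis (idx j) 1) ` A)"

(* The sum is the Minkowski sum of sets (Set_Algebras). *)
definition P_poly :: "(nat \<Rightarrow> 'm::finite) \<Rightarrow> nat \<Rightarrow> nat \<Rightarrow> nat \<Rightarrow> (real ^ 'm) set" where
  "P_poly idx n k s = (\<Sum>i\<in>{0..<n}. simplex_on idx (lam k s i))"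

(* The equation is  f x = c; the inequalities, indexed by I, are  g i x \<le> b i.
   They are indexed rather than collected in a set, so that a repetition in the list
   would violate the bijection with the facets; the bijection sends an inequality to the
   face on which it is tight. *)
definition minimal_inequality_description ::
  "'v::euclidean_space set \<Rightarrow> ('v \<Rightarrow> real) \<Rightarrow> real \<Rightarrow>
    'i set \<Rightarrow> ('i \<Rightarrow> 'v \<Rightarrow> real) \<Rightarrow> ('i \<Rightarrow> real) \<Rightarrow> bool" where
  "minimal_inequality_description P f c I g b \<longleftrightarrow>
     linear f \<and> (\<forall>i\<in>I. linear (g i)) \<and>
     affine hull P = {x. f x = c} \<and>
     P = {x. f x = c \<and> (\<forall>i\<in>I. g i x \<le> b i)} \<and>
     bij_betw (\<lambda>i. {x \<in> P. g i x = b i}) I {F. F facet_of P} \<and>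
     (\<forall>i\<in>I. P \<noteq> {x. f x = c \<and> (\<forall>j\<in>I - {i}. g j x \<le> b j)})"

datatype ineq = Initial nat | Final nat | Omit nat

fun ineq_lhs ::
  "(nat \<Rightarrow> 'm::finite) \<Rightarrow> nat \<Rightarrow> nat \<Rightarrow> nat \<Rightarrow> ineq \<Rightarrow> real ^ 'm \<Rightarrow> real" where
  "ineq_lhs idx n k s (Initial r) x =
     (\<Sum>i \<in> {0..<ambient_dim n k s} - (\<Union>j\<in>{0..r}. lam k s j). x $ idx i)"
| "ineq_lhs idx n k s (Final r) x =
     (\<Sum>i \<in> {0..<ambient_dim n k s} - (\<Union>j\<in>{r..n - 1}. lam k s j). x $ idx i)"
| "ineq_lhs idx n k s (Omit a) x =
     (\<Sum>i \<in> {0..<ambient_dim n k s} - {a}. x $ idx i)"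

fun ineq_rhs :: "nat \<Rightarrow> ineq \<Rightarrow> real" where
  "ineq_rhs n (Initial r) = real n - 1 - real r"
| "ineq_rhs n (Final r) = real r"
| "ineq_rhs n (Omit a) = real n"

(* r \<in> {0, ..., n - 2} is written r + 2 \<le> n because n - 2 truncates for n = 1. *)
definition union_ineqs :: "nat \<Rightarrow> ineq set" where
  "union_ineqs n = Initial ` {r. r + 2 \<le> n} \<union> Final ` {1..n - 1}"

end

theory Submission
  imports Defs
begin

text \<open>
  In terms of the prefix sums $F(t) = x_0 + \dots + x_{t-1}$ the inequalities say $F(sr) \le r$,
  $F(sr+k) \ge r+1$ and $x_a \ge 0$. They are clearly valid on the Minkowski sum. Conversely,
  they say that the mass of $x$ between the quantiles $i$ and $i+1$ lives on $\lambda_i$, so cutting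
  $x$ at its integer quantiles writes it as a sum of points of the simplices. For $k = s+1$ the
  inequality $x_{sr} \ge 0$ is the difference of $F(sr+1) \ge r$ and $F(sr) \le r$.

  The facets are read off from two kinds of points: the uniform point $n/K$ satisfies all
  inequalities strictly, and for every inequality a suitable arrangement of unit masses violates
  it alone. The segment joining the two leaves the polytope in a point where only that inequality
  is tight.
\<close>

section \<open>Minimality and facets from separating points\<close>

text \<open>Around \<open>w\<close> no inequality is active, so \<open>P\<close> has full dimension
  in the affine space \<open>f x = c\<close>. A point violating \<open>i\<close> alone shows that
  dropping \<open>i\<close> enlarges \<open>P\<close>, and for an irredundant family of half-spaces
  the facets are exactly the tight faces. Different indices have different faces because each face
  contains a point where only its own inequality is tight.\<close>

lemma minimal_inequality_descriptionI:
  fixes P :: "'v::euclidean_space set"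
  assumes "finite I"
    and linear_f: "linear f" and linear_g: "\<And>i. i \<in> I \<Longrightarrow> linear (g i)"
    and P: "P = {x. f x = c \<and> (\<forall>i\<in>I. g i x \<le> b i)}"
    and w: "f w = c" "\<And>i. i \<in> I \<Longrightarrow> g i w < b i"
    and violated: "\<And>i. i \<in> I \<Longrightarrow> \<exists>z. f z = c \<and> g i z > b i \<and> (\<forall>j\<in>I - {i}. g j z \<le> b j)"
  shows "minimal_inequality_description P f c I g b"
proof -
  have "\<forall>i\<in>I. \<exists>z. f z = c \<and> g i z > b i \<and> (\<forall>j\<in>I - {i}. g j z \<le> b j)"
    using violated by blast
  then obtain z where z_all: "\<forall>i\<in>I. f (z i) = c \<and> g i (z i) > b i \<and> (\<forall>j\<in>I - {i}. g j (z i) \<le> b j)"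
    unfolding bchoice_iff by blast
  have z: "f (z i) = c" "g i (z i) > b i" "\<And>j. j \<in> I \<Longrightarrow> j \<noteq> i \<Longrightarrow> g j (z i) \<le> b j"
    if "i \<in> I" for i
    using z_all that by auto
  have f_seg: "f (w + t *\<^sub>R (y - w)) = c" if "f y = c" for t y
    using that w linear_f by (simp add: linear_add linear_diff linear_scale)
  have g_seg: "g i (w + t *\<^sub>R (y - w)) = g i w + t * (g i y - g i w)" if "i \<in> I" for i t y
    using linear_g[OF that] by (simp add: linear_add linear_diff linear_scale)
  have affine: "affine hull P = {x. f x = c}"
  proof
    have "affine {x. f x = c}"
      using linear_f by (simp add: affine_def linear_add linear_scale flip: distrib_right)
    then show "affine hull P \<subseteq> {x. f x = c}"
      by (rule hull_minimal[rotated]) (use P in auto)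
    show "{x. f x = c} \<subseteq> affine hull P"
    proof
      fix y assume "y \<in> {x. f x = c}"
      then have y: "f y = c" by simp
      have "\<forall>\<^sub>F t in at_right 0. g i (w + t *\<^sub>R (y - w)) \<le> b i" if "i \<in> I" for i
      proof -
        have "((\<lambda>t. g i w + t * (g i y - g i w)) \<longlongrightarrow> g i w + 0 * (g i y - g i w)) (at_right 0)"
          by (intro tendsto_intros)
        then have "\<forall>\<^sub>F t in at_right 0. g i w + t * (g i y - g i w) < b i"
          using w(2)[OF that] by (intro order_tendstoD) auto
        then show ?thesis
          by eventually_elim (simp add: g_seg[OF that])
      qed
      then have "\<forall>\<^sub>F t in at_right 0. \<forall>i\<in>I. g i (w + t *\<^sub>R (y - w)) \<le> b i"
        using \<open>finite I\<close> by (simp add: eventually_ball_finite)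
      then have "\<forall>\<^sub>F t in at_right (0::real). t > 0 \<and> (\<forall>i\<in>I. g i (w + t *\<^sub>R (y - w)) \<le> b i)"
        using eventually_at_right_less by (rule eventually_conj[rotated])
      then obtain t :: real where t: "t > 0" "\<forall>i\<in>I. g i (w + t *\<^sub>R (y - w)) \<le> b i"
        using eventually_happens by (metis (no_types, lifting) trivial_limit_at_right_real)
      have "w + t *\<^sub>R (y - w) \<in> affine hull P" "w \<in> affine hull P"
        using t f_seg[OF y] w P by (auto intro!: hull_inc less_imp_le)
      \<comment> \<open>\<open>y\<close> is recovered by extrapolating from \<open>w\<close> through
        the nearby point; for \<open>t < 1\<close> the coefficient \<open>1 - 1 / t\<close> is
        negative, so the combination is affine but not convex.\<close>
      moreover have "y = (1 - 1 / t) *\<^sub>R w + (1 / t) *\<^sub>R (w + t *\<^sub>R (y - w))"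
        using \<open>t > 0\<close> by (simp add: algebra_simps)
      ultimately show "y \<in> affine hull P"
        using mem_affine[OF affine_affine_hull, of w P _ "1 - 1 / t" "1 / t"]
        by (metis diff_add_cancel)
    qed
  qed
  \<comment> \<open>The facet theorem for polyhedra speaks of a set of half-spaces, so the indexed
    family is replaced by its image under \<open>H\<close>. The points \<open>z i\<close> show that
    different indices give different half-spaces.\<close>
  define H where "H i = {x. g i x \<le> b i}" for i
  have z_H: "z i \<in> H j \<longleftrightarrow> j \<noteq> i" if "i \<in> I" "j \<in> I" for i j
    using z(2)[OF that(1)] z(3)[OF that] by (cases "j = i") (simp_all add: H_def)
  have "inj_on H I"
    using z_H by (metis inj_onI)
  \<comment> \<open>The adjoint at \<open>1\<close> is the vector that represents the functional
    \<open>g i\<close> through the inner product, that is, the normal of the half-space.\<close>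
  define a where "a h = adjoint (g (inv_into I H h)) 1" for h
  define \<beta> where "\<beta> h = b (inv_into I H h)" for h
  have a: "a (H i) \<bullet> x = g i x" and \<beta>: "\<beta> (H i) = b i" if "i \<in> I" for i x
    using \<open>inj_on H I\<close> that adjoint_works[OF linear_g[OF that], of x 1]
    by (simp_all add: a_def \<beta>_def inner_commute)
  have facets: "C facet_of P \<longleftrightarrow> (\<exists>h. h \<in> H ` I \<and> C = P \<inter> {x. a h \<bullet> x = \<beta> h})" for C
  proof (rule facet_of_polyhedron_explicit)
    show "finite (H ` I)"
      using \<open>finite I\<close> by simp
    show "P = affine hull P \<inter> \<Inter> (H ` I)"
      unfolding affine using P by (auto simp: H_def)
    show "a h \<noteq> 0 \<and> h = {x. a h \<bullet> x \<le> \<beta> h}" if "h \<in> H ` I" for h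
    proof -
      from that obtain i where i: "i \<in> I" "h = H i"
        by auto
      \<comment> \<open>A zero normal would make \<open>g i\<close> constant, yet it is below
        \<open>b i\<close> at \<open>w\<close> and above it at \<open>z i\<close>.\<close>
      have "a h \<noteq> 0"
      proof
        assume "a h = 0"
        then have "g i (z i) = g i w"
          using a[OF i(1)] i(2) by (metis inner_zero_left)
        then show False
          using z(2)[OF i(1)] w(2)[OF i(1)] by simp
      qed
      then show ?thesis
        using a i \<beta> by (simp add: H_def)
    qed
    show "P \<subset> affine hull P \<inter> \<Inter> F'" if F': "F' \<subset> H ` I" for F'
    proof -
      obtain i where i: "i \<in> I" "H i \<notin> F'"
        using F' by blast
      \<comment> \<open>\<open>z i\<close> satisfies every inequality but the \<open>i\<close>-th,
        so it enters the intersection as soon as \<open>H i\<close> is missing.\<close>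
      have "z i \<in> affine hull P \<inter> \<Inter> F'"
        using F' i z(1) z_H unfolding affine by (auto dest!: psubset_imp_subset)
      moreover have "z i \<notin> P"
        using P z(2)[OF i(1)] i(1) by (auto simp: not_le)
      moreover have "P \<subseteq> affine hull P \<inter> \<Inter> F'"
        using F' P unfolding affine H_def by auto
      ultimately show ?thesis
        by blast
    qed
  qed
  have face: "P \<inter> {x. a (H i) \<bullet> x = \<beta> (H i)} = {x \<in> P. g i x = b i}" if "i \<in> I" for i
    using a \<beta> that by auto
  have inj: "inj_on (\<lambda>i. {x \<in> P. g i x = b i}) I"
  proof (rule inj_onI, rule ccontr)
    fix i j assume ij: "i \<in> I" "j \<in> I" "i \<noteq> j"
      and eq: "{x \<in> P. g i x = b i} = {x \<in> P. g j x = b j}"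
    \<comment> \<open>The parameter at which \<open>g i\<close> reaches \<open>b i\<close> on the
      segment from \<open>w\<close> to \<open>z i\<close>. Every other inequality stays strict
      there, being strict at \<open>w\<close> and weak at \<open>z i\<close>.\<close>
    define t where "t = (b i - g i w) / (g i (z i) - g i w)"
    have t: "0 < t" "t < 1" "t * (g i (z i) - g i w) = b i - g i w"
      using z(2)[OF ij(1)] w(2)[OF ij(1)] by (auto simp: t_def divide_simps)
    define x where "x = w + t *\<^sub>R (z i - w)"
    have tight: "g i x = b i"
      using t(3) by (simp add: x_def g_seg ij(1))
    have strict: "g m x < b m" if "m \<in> I" "m \<noteq> i" for m
    proof -
      have "g m x = (1 - t) * g m w + t * g m (z i)"
        unfolding x_def g_seg[OF that(1)] by (simp add: algebra_simps)
      also have "\<dots> < (1 - t) * b m + t * b m"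
        using t w(2)[OF that(1)] z(3)[OF ij(1) that]
        by (intro add_less_le_mono mult_strict_left_mono mult_left_mono) auto
      finally show ?thesis
        by (simp add: algebra_simps)
    qed
    have "f x = c"
      unfolding x_def by (rule f_seg) (rule z(1)[OF ij(1)])
    then have "x \<in> {x \<in> P. g i x = b i}"
      using tight strict P by (auto intro: less_imp_le) (metis order.refl less_imp_le)
    then show False
      using eq strict[of j] ij by auto
  qed
  have image: "(\<lambda>i. {x \<in> P. g i x = b i}) ` I = {F. F facet_of P}"
    using face by (auto simp: facets)
  have irredundant: "P \<noteq> {x. f x = c \<and> (\<forall>j\<in>I - {i}. g j x \<le> b j)}" if "i \<in> I" for i
  proof -
    have "z i \<in> {x. f x = c \<and> (\<forall>j\<in>I - {i}. g j x \<le> b j)}" "z i \<notin> P"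
      using z[OF that] P that by (auto simp: not_le)
    then show ?thesis
      by blast
  qed
  show ?thesis
    unfolding minimal_inequality_description_def bij_betw_def
    by (intro conjI ballI linear_f linear_g affine P inj image irredundant)
qed

section \<open>Cutting a mass distribution at its integer quantiles\<close>

text \<open>Each summand is the length of the part of \<open>[0, t]\<close> inside
  \<open>[i, i + 1]\<close>, and these unit intervals tile \<open>[0, n]\<close>.\<close>

lemma sum_clamp:
  fixes t :: real
  shows "(\<Sum>i<n. max (real i) (min t (real i + 1)) - real i) = max 0 (min t (real n))"
  by (induction n) (auto simp: max_def min_def)

text \<open>The witness \<open>y i\<close> is the part of the mass of \<open>v\<close> between the quantiles \<open>i\<close> and \<open>i + 1\<close>.\<close>
lemma monotone_transport:
  fixes v :: "nat \<Rightarrow> real" and l u :: "nat \<Rightarrow> nat"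
  assumes nonneg: "\<And>j. j < K \<Longrightarrow> 0 \<le> v j"
    and total: "(\<Sum>j<K. v j) = real n"
    and l: "\<And>i. i < n \<Longrightarrow> l i \<le> K" "\<And>i. i < n \<Longrightarrow> (\<Sum>j<l i. v j) \<le> real i"
    and u: "\<And>i. i < n \<Longrightarrow> (\<Sum>j<u i. v j) \<ge> real i + 1"
  obtains y :: "nat \<Rightarrow> nat \<Rightarrow> real" where
    "\<And>i j. j < K \<Longrightarrow> 0 \<le> y i j"
    "\<And>i. i < n \<Longrightarrow> (\<Sum>j<K. y i j) = 1"
    "\<And>i j. i < n \<Longrightarrow> j < K \<Longrightarrow> j \<notin> {l i..<u i} \<Longrightarrow> y i j = 0"
    "\<And>j. j < K \<Longrightarrow> (\<Sum>i<n. y i j) = v j"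
proof
  define F where "F t = (\<Sum>j<t. v j)" for t
  define clamp where "clamp i t = max (real i) (min t (real i + 1))" for i t
  have F_mono: "F p \<le> F q" if "p \<le> q" "q \<le> K" for p q
    unfolding F_def using that nonneg by (intro sum_mono2) auto
  have F_Suc: "F (Suc j) = F j + v j" for j
    by (simp add: F_def)
  have F_ends: "F 0 = 0" "F K = real n"
    using total by (simp_all add: F_def)
  let ?y = "\<lambda>i j. clamp i (F (Suc j)) - clamp i (F j)"
  show "0 \<le> ?y i j" if "j < K" for i j
    using nonneg[OF that] by (auto simp: clamp_def F_Suc)
  show "(\<Sum>j<K. ?y i j) = 1" if "i < n" for i
    unfolding sum_lessThan_telescope[of "\<lambda>j. clamp i (F j)"]
    using that by (simp add: F_ends clamp_def)
  \<comment> \<open>Left of \<open>l i\<close> the prefix sums are at most \<open>i\<close>, from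
    \<open>u i\<close> on they are at least \<open>i + 1\<close>; \<open>clamp i\<close> is constant
    on either range.\<close>
  show "?y i j = 0" if ij: "i < n" "j < K" "j \<notin> {l i..<u i}" for i j
  proof (cases "j < l i")
    case True
    then have "F (Suc j) \<le> real i" "F j \<le> real i"
      using F_mono[of "Suc j" "l i"] F_mono[of j "l i"] l[OF ij(1)] by (auto simp: F_def)
    then show ?thesis
      by (simp add: clamp_def)
  next
    case False
    then have "F (u i) \<le> F j" "F j \<le> F (Suc j)"
      using F_mono[of "u i" j] F_mono[of j "Suc j"] ij by auto
    then show ?thesis
      using u[OF ij(1)] by (simp add: clamp_def F_def)
  qed
  show "(\<Sum>i<n. ?y i j) = v j" if "j < K" for j
  proof -
    \<comment> \<open>\<open>F p\<close> lies between \<open>0\<close> and \<open>n\<close>, so the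
      truncation in \<open>sum_clamp\<close> has no effect.\<close>
    have sum: "(\<Sum>i<n. clamp i (F p) - real i) = F p" if "p \<le> K" for p
      using F_mono[of 0 p] F_mono[of p K] that F_ends
      unfolding clamp_def by (simp add: sum_clamp)
    have "(\<Sum>i<n. ?y i j)
        = (\<Sum>i<n. clamp i (F (Suc j)) - real i) - (\<Sum>i<n. clamp i (F j) - real i)"
      by (simp add: sum_subtractf)
    then show ?thesis
      using sum[of "Suc j"] sum[of j] that by (simp add: F_Suc)
  qed
qed

section \<open>Counting unit masses in a prefix\<close>

text \<open>Reading \<open>q i\<close> as the position of the \<open>i\<close>-th unit mass, this
  turns prefix sums of the resulting vector into counts.\<close>

lemma sum_card_fibres:
  fixes q :: "nat \<Rightarrow> nat"
  shows "(\<Sum>j<t. real (card {i. i < n \<and> q i = j})) = real (card {i. i < n \<and> q i < t})"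
proof (induction t)
  case (Suc t)
  have "{i. i < n \<and> q i < Suc t} = {i. i < n \<and> q i < t} \<union> {i. i < n \<and> q i = t}"
    by auto
  then have "card {i. i < n \<and> q i < Suc t} = card {i. i < n \<and> q i < t} + card {i. i < n \<and> q i = t}"
    by (simp add: card_Un_disjoint disjoint_iff)
  with Suc show ?case
    by simp
qed simp

lemma card_less_le:
  fixes q :: "nat \<Rightarrow> nat"
  assumes "\<And>i. q i < t \<Longrightarrow> i < r"
  shows "card {i. i < n \<and> q i < t} \<le> r"
proof -
  have "{i. i < n \<and> q i < t} \<subseteq> {..<r}"
    using assms by auto
  from card_mono[OF _ this] show ?thesis
    by simp
qed

lemma le_card_less:
  fixes q :: "nat \<Rightarrow> nat"
  assumes "\<And>i. i < r \<Longrightarrow> q i < t" "r \<le> n"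
  shows "r \<le> card {i. i < n \<and> q i < t}"
proof -
  have "{..<r} \<subseteq> {i. i < n \<and> q i < t}"
    using assms by auto
  from card_mono[OF _ this] show ?thesis
    by simp
qed

section \<open>Unions of blocks and coordinates of simplices\<close>

text \<open>With \<open>s \<le> k\<close> each block starts no later than its predecessor ends, so
  the union has no gaps.\<close>

lemma UN_lam_initial:
  assumes "s \<le> k"
  shows "(\<Union>i\<in>{0..r}. lam k s i) = {0..<s * r + k}"
proof (induction r)
  case (Suc r)
  then show ?case
    using assms by (auto simp: lam_def atLeast0_atMost_Suc)
qed (simp add: lam_def)

lemma UN_lam_final:
  assumes "s \<le> k" "r \<le> m"
  shows "(\<Union>i\<in>{r..m}. lam k s i) = {s * r..<s * m + k}"
  using assms(2)
proof (induction rule: dec_induct)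
  case (step i)
  then have "s * r \<le> x" if "s * Suc i \<le> x" for x
    using that by (meson le_SucI le_trans mult_le_mono2)
  moreover have "{r..Suc i} = insert (Suc i) {r..i}"
    using step by auto
  ultimately show ?case
    using assms step by (auto simp: lam_def)
qed (auto simp: lam_def)

text \<open>The right-hand side is convex and contains the vertices. Conversely, the coordinates of
  one of its points serve as the convex weights.\<close>

lemma simplex_on_eq:
  fixes idx :: "nat \<Rightarrow> 'm::finite"
  assumes idx: "bij_betw idx {0..<K} UNIV" and A: "A \<subseteq> {0..<K}"
  shows "simplex_on idx A = {y. (\<forall>j<K. 0 \<le> y $ idx j) \<and> (\<Sum>j<K. y $ idx j) = 1 \<and>
    (\<forall>j<K. j \<notin> A \<longrightarrow> y $ idx j = 0)}" (is "_ = ?S")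
proof
  have inj: "idx i = idx j \<longleftrightarrow> i = j" if "i < K" "j < K" for i j
    using idx that by (auto simp: bij_betw_def inj_on_def)
  have "axis (idx j) 1 \<in> ?S" if "j \<in> A" for j
  proof -
    have "j < K"
      using that A by auto
    moreover have "(\<Sum>i<K. (axis (idx j) 1 :: real ^ 'm) $ idx i) = (\<Sum>i<K. if i = j then 1 else 0)"
      using \<open>j < K\<close> inj by (intro sum.cong) (auto simp: axis_def)
    ultimately show ?thesis
      using inj that by (auto simp: axis_def)
  qed
  moreover have "convex ?S"
    by (auto simp: convex_def sum.distrib simp flip: sum_distrib_left)
  ultimately show "simplex_on idx A \<subseteq> ?S"
    unfolding simplex_on_def by (intro hull_minimal) auto
  show "?S \<subseteq> simplex_on idx A"
  proof
    fix y assume y: "y \<in> ?S"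
    have restrict: "(\<Sum>j<K. h j) = (\<Sum>j\<in>A. h j)" if "\<And>j. j < K \<Longrightarrow> j \<notin> A \<Longrightarrow> h j = 0"
      for h :: "nat \<Rightarrow> 'b::comm_monoid_add"
      using A that by (intro sum.mono_neutral_right) auto
    have "(\<Sum>j\<in>A. (y $ idx j) *\<^sub>R axis (idx j) 1) \<in> convex hull ((\<lambda>j. axis (idx j) (1::real)) ` A)"
      using y A restrict[of "\<lambda>j. y $ idx j"] finite_subset[OF A]
      by (intro convex_sum) (auto intro: hull_inc)
    moreover have "(\<Sum>j\<in>A. (y $ idx j) *\<^sub>R axis (idx j) 1) = y"
    proof -
      have "(\<Sum>j\<in>A. (y $ idx j) *\<^sub>R axis (idx j) 1)
          = (\<Sum>j\<in>{0..<K}. (y $ idx j) *\<^sub>R axis (idx j) (1::real))"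
        using y restrict[of "\<lambda>j. (y $ idx j) *\<^sub>R axis (idx j) (1::real)"]
        by (simp add: lessThan_atLeast0)
      also have "\<dots> = (\<Sum>m\<in>UNIV. (y $ m) *\<^sub>R axis m 1)"
        by (rule sum.reindex_bij_betw[OF idx])
      also have "\<dots> = y"
        using basis_expansion[of y] by (simp add: scalar_mult_eq_scaleR)
      finally show ?thesis .
    qed
    ultimately show "y \<in> simplex_on idx A"
      by (simp add: simplex_on_def)
  qed
qed


lemma linear_ineq_lhs: "linear (ineq_lhs idx n k s i)"
  by (cases i) (simp_all add: linear_iff sum.distrib sum_distrib_left)

section \<open>The polytope in terms of prefix sums\<close>

context
  fixes n k s K :: nat and idx :: "nat \<Rightarrow> 'm::finite"
  assumes n: "n > 0" and s: "s > 0" and k: "s < k"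
    and K: "K = ambient_dim n k s"
    and idx: "bij_betw idx {0..<K} (UNIV :: 'm set)"
begin

lemma block_le: "i < n \<Longrightarrow> s * i + k \<le> K"
  using mult_le_mono2[of i "n - 1" s] by (auto simp: K ambient_dim_def)

lemma block_less: "Suc i < n \<Longrightarrow> s * i + k < K"
  using block_le[of "Suc i"] s by simp

lemma lam_subset: "i < n \<Longrightarrow> lam k s i \<subseteq> {0..<K}"
  using block_le[of i] by (auto simp: lam_def)

lemma ineq_lhs_Initial:
  assumes "r < n"
  shows "ineq_lhs idx n k s (Initial r) x = (\<Sum>j<K. x $ idx j) - (\<Sum>j<s * r + k. x $ idx j)"
proof -
  have "{0..<K} - (\<Union>j\<in>{0..r}. lam k s j) = {..<K} - {..<s * r + k}"
    using k by (simp add: UN_lam_initial lessThan_atLeast0)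
  then show ?thesis
    using block_le[OF assms] by (simp add: sum_diff del: lessThan_minus_lessThan flip: K)
qed

lemma ineq_lhs_Final:
  assumes "r < n"
  shows "ineq_lhs idx n k s (Final r) x = (\<Sum>j<s * r. x $ idx j)"
proof -
  have "(\<Union>j\<in>{r..n - 1}. lam k s j) = {s * r..<K}"
    using assms k UN_lam_final[of s k r "n - 1"] by (auto simp: K ambient_dim_def)
  then have "{0..<K} - (\<Union>j\<in>{r..n - 1}. lam k s j) = {..<s * r}"
    using block_le[OF assms] by auto
  then show ?thesis
    by (simp flip: K)
qed

lemma ineq_lhs_Omit:
  assumes "a < K"
  shows "ineq_lhs idx n k s (Omit a) x = (\<Sum>j<K. x $ idx j) - x $ idx a"
  using assms by (simp add: sum_diff1 flip: K lessThan_atLeast0)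

text \<open>For a point of the Minkowski sum, count the summands whose unit mass must lie inside or
  outside a given prefix. The converse is \<open>monotone_transport\<close> with the block ends as
  \<open>l\<close> and \<open>u\<close>; it wants bounds for every block, hence the range
  \<open>r < n\<close> including the trivial ends.\<close>

lemma P_poly_eq:
  "P_poly idx n k s = {x. (\<forall>j<K. 0 \<le> x $ idx j) \<and> (\<Sum>j<K. x $ idx j) = real n \<and>
    (\<forall>r<n. (\<Sum>j<s * r. x $ idx j) \<le> real r \<and> real r + 1 \<le> (\<Sum>j<s * r + k. x $ idx j))}"
  (is "_ = ?Q")
proof
  show "P_poly idx n k s \<subseteq> ?Q"
  proof
    fix x assume "x \<in> P_poly idx n k s"
    then obtain y where x: "x = (\<Sum>i\<in>{0..<n}. y i)"
      and "\<And>i. i < n \<Longrightarrow> y i \<in> simplex_on idx (lam k s i)"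
      unfolding P_poly_def by (auto simp: set_sum_alt)
    then have nonneg: "0 \<le> y i $ idx j" and total: "(\<Sum>j<K. y i $ idx j) = 1"
      and support: "j \<notin> lam k s i \<Longrightarrow> y i $ idx j = 0" if "i < n" "j < K" for i j
      using that lam_subset simplex_on_eq[OF idx] by blast+
    \<comment> \<open>The fact just obtained carries an index \<open>j < K\<close> along;
      \<open>K > 0\<close> supplies one.\<close>
    have total: "(\<Sum>j<K. y i $ idx j) = 1" if "i < n" for i
      using total[OF that] block_le[OF n] k by fastforce
    have sums: "(\<Sum>j<t. x $ idx j) = (\<Sum>i<n. \<Sum>j<t. y i $ idx j)" for t
      by (simp add: x lessThan_atLeast0 sum.swap[of _ "{0..<n}"])
    have "(\<Sum>j<s * r. x $ idx j) \<le> real r" if "r < n" for r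
    proof -
      \<comment> \<open>Summands \<open>i < r\<close> contribute at most their whole mass; the
        others have blocks starting at or after \<open>s * r\<close> and contribute nothing.\<close>
      have "(\<Sum>j<s * r. y i $ idx j) \<le> (if i < r then 1 else 0)" if "i < n" for i
      proof (cases "i < r")
        case True
        have "(\<Sum>j<s * r. y i $ idx j) \<le> (\<Sum>j<K. y i $ idx j)"
          using block_le[OF \<open>r < n\<close>] nonneg that by (intro sum_mono2) auto
        then show ?thesis
          using True total[OF that] by simp
      next
        case False
        then have le: "s * r \<le> s * i" by simp
        have "y i $ idx j = 0" if "j < s * r" for j
        proof (rule support[OF \<open>i < n\<close>])
          show "j < K"
            using block_le[OF \<open>i < n\<close>] le that by linarith
          show "j \<notin> lam k s i"
            unfolding lam_def atLeastLessThan_iff using le that by linarith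
        qed
        then have "(\<Sum>j<s * r. y i $ idx j) = 0"
          by simp
        then show ?thesis
          using False by simp
      qed
      then have "(\<Sum>j<s * r. x $ idx j) \<le> (\<Sum>i<n. if i < r then 1 else 0)"
        unfolding sums by (intro sum_mono) auto
      also have "\<dots> = (\<Sum>i<r. 1)"
        using that by (intro sum.mono_neutral_cong_right) auto
      finally show ?thesis
        by simp
    qed
    moreover have "real r + 1 \<le> (\<Sum>j<s * r + k. x $ idx j)" if "r < n" for r
    proof -
      \<comment> \<open>Blocks up to \<open>r\<close> lie inside the prefix and contribute mass
        \<open>1\<close>; the others contribute a nonnegative amount.\<close>
      have "(if i < Suc r then 1 else 0) \<le> (\<Sum>j<s * r + k. y i $ idx j)" if "i < n" for i
      proof (cases "i < Suc r")
        case True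
        then have le: "s * i \<le> s * r" by simp
        have "y i $ idx j = 0" if "j < K" "s * r + k \<le> j" for j
        proof (rule support[OF \<open>i < n\<close> \<open>j < K\<close>])
          show "j \<notin> lam k s i"
            unfolding lam_def atLeastLessThan_iff using le that by linarith
        qed
        then have "(\<Sum>j<s * r + k. y i $ idx j) = (\<Sum>j<K. y i $ idx j)"
          using block_le[OF \<open>r < n\<close>] by (intro sum.mono_neutral_left) auto
        then show ?thesis
          using True total[OF that] by simp
      next
        case False
        then show ?thesis
          using block_le[OF \<open>r < n\<close>] nonneg that by (auto intro!: sum_nonneg)
      qed
      then have "(\<Sum>i<n. if i < Suc r then 1 else 0) \<le> (\<Sum>j<s * r + k. x $ idx j)"
        unfolding sums by (intro sum_mono) auto
      moreover have "(\<Sum>i<n. if i < Suc r then 1 else 0) = (\<Sum>i<Suc r. 1::real)"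
        using that by (intro sum.mono_neutral_cong_right) auto
      ultimately show ?thesis
        by simp
    qed
    moreover have "0 \<le> x $ idx j" if "j < K" for j
      unfolding x using nonneg that by (auto intro!: sum_nonneg)
    moreover have "(\<Sum>j<K. x $ idx j) = real n"
      by (simp add: sums total)
    ultimately show "x \<in> ?Q"
      by blast
  qed
  show "?Q \<subseteq> P_poly idx n k s"
  proof
    fix x assume x: "x \<in> ?Q"
    obtain y :: "nat \<Rightarrow> nat \<Rightarrow> real" where y: "\<And>i j. j < K \<Longrightarrow> 0 \<le> y i j"
      "\<And>i. i < n \<Longrightarrow> (\<Sum>j<K. y i j) = 1"
      "\<And>i j. i < n \<Longrightarrow> j < K \<Longrightarrow> j \<notin> {s * i..<s * i + k} \<Longrightarrow> y i j = 0"
      "\<And>j. j < K \<Longrightarrow> (\<Sum>i<n. y i j) = x $ idx j"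
    proof (rule monotone_transport[of K "\<lambda>j. x $ idx j" n "\<lambda>i. s * i" "\<lambda>i. s * i + k"])
      show "s * i \<le> K" if "i < n" for i
        using block_le[OF that] by simp
    qed (use x in blast)+
    define Y where "Y i = (\<chi> m. y i (inv_into {0..<K} idx m))" for i
    have Y: "Y i $ idx j = y i j" if "j < K" for i j
      using that idx by (simp add: Y_def bij_betw_def)
    have "x $ m = (\<Sum>i\<in>{0..<n}. Y i) $ m" for m
    proof -
      obtain j where "j < K" "m = idx j"
        using idx by (force simp: bij_betw_def)
      then show ?thesis
        using y(4) by (simp add: Y lessThan_atLeast0)
    qed
    then have "x = (\<Sum>i\<in>{0..<n}. Y i)"
      by (simp add: vec_eq_iff)
    moreover have "Y i \<in> simplex_on idx (lam k s i)" if "i < n" for i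
      unfolding simplex_on_eq[OF idx lam_subset[OF that]] using that y Y by (simp add: lam_def)
    ultimately show "x \<in> P_poly idx n k s"
      unfolding P_poly_def by (auto simp: set_sum_alt)
  qed
qed


section \<open>The listed inequalities cut out the polytope\<close>

text \<open>One index set for both cases of the theorem, so that the argument runs once under
  \<open>s < k\<close>. When \<open>k = s + 1\<close>, \<open>s * r\<close> is
  \<open>r * (k - 1)\<close>.\<close>

definition facet_ineqs :: "ineq set" where
  "facet_ineqs = union_ineqs n \<union>
     Omit ` {a \<in> {0..<K}. \<not> (k = s + 1 \<and> (\<exists>r\<in>{1..n - 1}. a = s * r))}"

lemma facet_ineqs_cases [consumes 1, case_names Initial Final Omit]:
  assumes "i \<in> facet_ineqs"
  obtains r where "i = Initial r" "Suc r < n"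
    | r where "i = Final r" "0 < r" "r < n"
    | a where "i = Omit a" "a < K" "\<And>r. k = s + 1 \<Longrightarrow> 0 < r \<Longrightarrow> r < n \<Longrightarrow> a \<noteq> s * r"
proof -
  from assms consider r where "i = Initial r" "r + 2 \<le> n" | r where "i = Final r" "r \<in> {1..n - 1}"
    | a where "i = Omit a" "a < K" "\<not> (k = s + 1 \<and> (\<exists>r\<in>{1..n - 1}. a = s * r))"
    unfolding facet_ineqs_def union_ineqs_def by auto
  then show ?thesis
  proof cases
    case (3 a)
    moreover have "a \<noteq> s * r" if "k = s + 1" "0 < r" "r < n" for r
      using 3(3) that by auto
    ultimately show ?thesis
      using that(3) by blast
  qed (use that(1,2) in auto)
qed

lemma finite_facet_ineqs: "finite facet_ineqs"
proof -
  have "{r. r + 2 \<le> n} \<subseteq> {..<n}"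
    by auto
  then show ?thesis
    unfolding facet_ineqs_def union_ineqs_def by (auto intro: finite_subset)
qed

lemma ineq_iff:
  assumes "(\<Sum>j<K. x $ idx j) = real n"
  shows "r < n \<Longrightarrow> ineq_lhs idx n k s (Initial r) x \<le> ineq_rhs n (Initial r)
      \<longleftrightarrow> real r + 1 \<le> (\<Sum>j<s * r + k. x $ idx j)"
    and "r < n \<Longrightarrow> ineq_lhs idx n k s (Final r) x \<le> ineq_rhs n (Final r)
      \<longleftrightarrow> (\<Sum>j<s * r. x $ idx j) \<le> real r"
    and "a < K \<Longrightarrow> ineq_lhs idx n k s (Omit a) x \<le> ineq_rhs n (Omit a) \<longleftrightarrow> 0 \<le> x $ idx a"
  using assms
  by (auto simp: ineq_lhs_Initial ineq_lhs_Final ineq_lhs_Omit simp del: ineq_lhs.simps)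

text \<open>What \<open>P_poly_eq\<close> demands beyond the list is implied: the bound for
  \<open>r = 0\<close> concerns an empty sum, the one for \<open>r = n - 1\<close> is the total, and
  the omitted nonnegativity conditions follow from two neighbouring prefix bounds.\<close>

lemma P_poly_facet_ineqs:
  "P_poly idx n k s =
    {x. (\<Sum>j<K. x $ idx j) = real n \<and> (\<forall>i\<in>facet_ineqs. ineq_lhs idx n k s i x \<le> ineq_rhs n i)}"
  (is "_ = ?R")
proof
  show "P_poly idx n k s \<subseteq> ?R"
  proof (clarsimp simp: P_poly_eq simp del: ineq_lhs.simps ineq_rhs.simps)
    fix x i
    assume x: "\<forall>j<K. 0 \<le> x $ idx j"
      "\<forall>r<n. (\<Sum>j<s * r. x $ idx j) \<le> real r \<and> real r + 1 \<le> (\<Sum>j<s * r + k. x $ idx j)"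
      and total: "(\<Sum>j<K. x $ idx j) = real n"
    assume "i \<in> facet_ineqs"
    then show "ineq_lhs idx n k s i x \<le> ineq_rhs n i"
      by (cases i rule: facet_ineqs_cases) (use x in \<open>simp_all only: ineq_iff[OF total] Suc_lessD\<close>)
  qed
  show "?R \<subseteq> P_poly idx n k s"
  proof
    fix x assume "x \<in> ?R"
    then have total: "(\<Sum>j<K. x $ idx j) = real n"
      and i: "\<And>i. i \<in> facet_ineqs \<Longrightarrow> ineq_lhs idx n k s i x \<le> ineq_rhs n i"
      by auto
    have before: "(\<Sum>j<s * r. x $ idx j) \<le> real r" if "r < n" for r
    proof (cases "r = 0")
      case False
      then have "Final r \<in> facet_ineqs"
        using that by (auto simp: facet_ineqs_def union_ineqs_def)
      from i[OF this] show ?thesis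
        by (simp only: ineq_iff[OF total] that)
    qed simp
    have upto: "real r + 1 \<le> (\<Sum>j<s * r + k. x $ idx j)" if "r < n" for r
    proof (cases "Suc r = n")
      case True
      then have "s * r + k = K"
        by (auto simp: K ambient_dim_def)
      then show ?thesis
        using total True by auto
    next
      case False
      then have "Initial r \<in> facet_ineqs"
        using that by (auto simp: facet_ineqs_def union_ineqs_def)
      from i[OF this] show ?thesis
        by (simp only: ineq_iff[OF total] that)
    qed
    have "0 \<le> x $ idx a" if a: "a < K" for a
    proof (cases "Omit a \<in> facet_ineqs")
      case True
      from i[OF this] show ?thesis
        by (simp only: ineq_iff[OF total] a)
    next
      case False
      then have "k = s + 1" "\<exists>r\<in>{1..n - 1}. a = s * r"
        using a by (auto simp: facet_ineqs_def)
      moreover from this(2) obtain r where "r \<in> {1..n - 1}" "a = s * r"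
        by blast
      moreover from this(1) have "0 < r" "r < n"
        by auto
      \<comment> \<open>Here \<open>a\<close> is both the last index of block \<open>r - 1\<close>
        and the first of block \<open>r\<close>, so \<open>x $ idx a\<close> is a difference of two
        bounded prefix sums.\<close>
      moreover from calculation have "s * (r - 1) + k = Suc a" "r - 1 < n"
        by (cases r; auto)+
      ultimately show ?thesis
        using before[of r] upto[of "r - 1"] by (auto simp: of_nat_diff)
    qed
    then show "x \<in> P_poly idx n k s"
      unfolding P_poly_eq using total before upto by blast
  qed
qed

section \<open>A strictly feasible point and unit-mass configurations\<close>

lemma obtain_vec:
  obtains x :: "real ^ 'm" where "\<And>j. j < K \<Longrightarrow> x $ idx j = v j"
    "\<And>t. t \<le> K \<Longrightarrow> (\<Sum>j<t. x $ idx j) = (\<Sum>j<t. v j)"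
proof
  let ?x = "\<chi> m. v (inv_into {0..<K} idx m)"
  show x: "?x $ idx j = v j" if "j < K" for j
    using that idx by (simp add: bij_betw_def)
  show "(\<Sum>j<t. ?x $ idx j) = (\<Sum>j<t. v j)" if "t \<le> K" for t
    using that by (intro sum.cong refl x) auto
qed

text \<open>The uniform point with all coordinates \<open>n / K\<close> works; every strict
  inequality reduces to \<open>s < k\<close> or to \<open>n > 0\<close>.\<close>

lemma strict_point:
  obtains w :: "real ^ 'm" where "(\<Sum>j<K. w $ idx j) = real n"
    "\<And>i. i \<in> facet_ineqs \<Longrightarrow> ineq_lhs idx n k s i w < ineq_rhs n i"
proof -
  obtain w :: "real ^ 'm" where w: "\<And>j. j < K \<Longrightarrow> w $ idx j = real n / real K"
    "\<And>t. t \<le> K \<Longrightarrow> (\<Sum>j<t. w $ idx j) = (\<Sum>j<t. real n / real K)"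
    using obtain_vec[of "\<lambda>_. real n / real K"] by blast
  have "K > 0"
    using block_le[OF n] k by simp
  have real_K: "real K = real s * (real n - 1) + real k"
    using n by (simp add: K ambient_dim_def of_nat_diff)
  have total: "(\<Sum>j<K. w $ idx j) = real n"
    using w(2)[of K] \<open>K > 0\<close> by simp
  have "ineq_lhs idx n k s i w < ineq_rhs n i" if "i \<in> facet_ineqs" for i
    using that
  proof (cases i rule: facet_ineqs_cases)
    case (Initial r)
    \<comment> \<open>After expanding \<open>K\<close>, this is exactly the cross-multiplied claim
      \<open>(r + 1) * K < (s * r + k) * n\<close>; strictness comes from
      \<open>r + 1 < n\<close>.\<close>
    have "real s * (real n - 1 - real r) < real k * (real n - 1 - real r)"
      using Initial k by (intro mult_strict_right_mono) auto
    then have "(real r + 1) * real K < real (s * r + k) * real n"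
      by (simp add: real_K algebra_simps)
    then have "real r + 1 < real (s * r + k) * real n / real K"
      using \<open>K > 0\<close> by (simp add: pos_less_divide_eq)
    then show ?thesis
      using Initial block_le[of r] total
      by (simp add: ineq_lhs_Initial w(2) del: ineq_lhs.simps of_nat_add of_nat_mult)
  next
    case (Final r)
    \<comment> \<open>This rests on \<open>K = s * n + (k - s) > s * n\<close>.\<close>
    have "real n * real s * real r < real K * real r"
      using Final k by (intro mult_strict_right_mono) (auto simp: real_K algebra_simps)
    then have "real (s * r) * real n / real K < real r"
      using \<open>K > 0\<close> by (simp add: pos_divide_less_eq algebra_simps)
    then show ?thesis
      using Final block_le[of r]
      by (simp add: ineq_lhs_Final w(2) del: ineq_lhs.simps of_nat_mult)
  next
    case (Omit a)
    then show ?thesis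
      using w(1) total n \<open>K > 0\<close> by (simp add: ineq_lhs_Omit del: ineq_lhs.simps)
  qed
  with total that show ?thesis
    by blast
qed

text \<open>The vector has unit masses at the positions \<open>q i\<close>, after which one unit is
  moved from \<open>a\<close> to \<open>b\<close>. If no mass sits at \<open>a\<close>, that
  coordinate becomes \<open>-1\<close>; \<open>a = b\<close> means that nothing is moved.\<close>

lemma unit_masses:
  assumes q: "\<And>i. i < n \<Longrightarrow> q i < K" and ab: "a < K" "b < K"
  obtains z :: "real ^ 'm" where "(\<Sum>j<K. z $ idx j) = real n"
    "\<And>r. r < n \<Longrightarrow> ineq_lhs idx n k s (Initial r) z \<le> ineq_rhs n (Initial r) \<longleftrightarrow>
      real r + 1 + of_bool (a < s * r + k) \<le>
        real (card {i. i < n \<and> q i < s * r + k}) + of_bool (b < s * r + k)"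
    "\<And>r. r < n \<Longrightarrow> ineq_lhs idx n k s (Final r) z \<le> ineq_rhs n (Final r) \<longleftrightarrow>
      real (card {i. i < n \<and> q i < s * r}) + of_bool (b < s * r) \<le>
        real r + of_bool (a < s * r)"
    "\<And>j. j < K \<Longrightarrow> ineq_lhs idx n k s (Omit j) z \<le> ineq_rhs n (Omit j) \<longleftrightarrow>
      of_bool (j = a) \<le> real (card {i. i < n \<and> q i = j}) + of_bool (j = b)"
proof -
  define v where
    "v j = real (card {i. i < n \<and> q i = j}) + of_bool (j = b) - of_bool (j = a)" for j
  have v_sum: "(\<Sum>j<t. v j)
      = real (card {i. i < n \<and> q i < t}) + of_bool (b < t) - of_bool (a < t)" for t
    by (simp add: v_def sum.distrib sum_subtractf sum_card_fibres)
  obtain z :: "real ^ 'm" where z: "\<And>j. j < K \<Longrightarrow> z $ idx j = v j"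
    "\<And>t. t \<le> K \<Longrightarrow> (\<Sum>j<t. z $ idx j) = (\<Sum>j<t. v j)"
    using obtain_vec[of v] by blast
  have "{i. i < n \<and> q i < K} = {..<n}"
    using q by auto
  then have total: "(\<Sum>j<K. z $ idx j) = real n"
    using ab by (simp add: z v_sum)
  show ?thesis
  proof
    show "ineq_lhs idx n k s (Initial r) z \<le> ineq_rhs n (Initial r) \<longleftrightarrow>
      real r + 1 + of_bool (a < s * r + k) \<le>
        real (card {i. i < n \<and> q i < s * r + k}) + of_bool (b < s * r + k)" if "r < n" for r
      unfolding ineq_iff(1)[OF total that] z(2)[OF block_le[OF that]] v_sum by linarith
    show "ineq_lhs idx n k s (Final r) z \<le> ineq_rhs n (Final r) \<longleftrightarrow>
      real (card {i. i < n \<and> q i < s * r}) + of_bool (b < s * r) \<le>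
        real r + of_bool (a < s * r)" if "r < n" for r
      unfolding ineq_iff(2)[OF total that] z(2)[OF add_leD1[OF block_le[OF that]]] v_sum
      by linarith
    show "ineq_lhs idx n k s (Omit j) z \<le> ineq_rhs n (Omit j) \<longleftrightarrow>
      of_bool (j = a) \<le> real (card {i. i < n \<and> q i = j}) + of_bool (j = b)" if "j < K" for j
      unfolding ineq_iff(3)[OF total that] z(1)[OF that] v_def by linarith
  qed (rule total)
qed

section \<open>Points violating exactly one inequality\<close>

text \<open>Each block holds its unit at its last position, except that the unit of block
  \<open>r\<close> is pushed one place past the end. The prefix ending with block \<open>r\<close>
  then has only \<open>r\<close> units, while later block ends, at least \<open>s\<close> further,
  still include the displaced one.\<close>

lemma Initial_violated_alone:
  assumes r: "Suc r < n"
  obtains z :: "real ^ 'm" where "(\<Sum>j<K. z $ idx j) = real n"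
    "\<And>j. j \<in> facet_ineqs \<Longrightarrow> ineq_lhs idx n k s j z \<le> ineq_rhs n j \<longleftrightarrow> j \<noteq> Initial r"
proof -
  define q where "q i = (if i = r then s * r + k else s * i + k - 1)" for i
  have q_less: "q i < K" if "i < n" for i
    using block_le[OF that] block_less[OF r] k by (auto simp: q_def)
  have q_before: "i < r'" if "q i < s * r'" for i r'
  proof -
    have "s * i \<le> q i"
      using k by (auto simp: q_def)
    from this that have "s * i < s * r'"
      by (rule le_less_trans)
    then show ?thesis
      by simp
  qed
  have q_upto: "q i < s * r' + k" if "i \<le> r'" "r' \<noteq> r" for i r'
  proof (cases "i = r")
    case True
    then show ?thesis
      using that s by (simp add: q_def)
  next
    case False
    have "s * i \<le> s * r'"
      using that by simp
    then have "s * i + k - 1 < s * r' + k"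
      using k by linarith
    then show ?thesis
      using False by (simp add: q_def)
  qed
  have q_upto_r: "i < r" if "q i < s * r + k" for i
  proof -
    have neq: "i \<noteq> r" and "s * i < s * Suc r"
      using that k s by (auto simp: q_def split: if_splits)
    from this(2) have "i < Suc r"
      by (simp only: mult_less_cancel1)
    with neq show ?thesis
      by simp
  qed
  obtain z :: "real ^ 'm" where z: "(\<Sum>j<K. z $ idx j) = real n"
    "\<And>r. r < n \<Longrightarrow> ineq_lhs idx n k s (Initial r) z \<le> ineq_rhs n (Initial r) \<longleftrightarrow>
      real r + 1 \<le> real (card {i. i < n \<and> q i < s * r + k})"
    "\<And>r. r < n \<Longrightarrow> ineq_lhs idx n k s (Final r) z \<le> ineq_rhs n (Final r) \<longleftrightarrow>
      real (card {i. i < n \<and> q i < s * r}) \<le> real r"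
    "\<And>j. j < K \<Longrightarrow> ineq_lhs idx n k s (Omit j) z \<le> ineq_rhs n (Omit j)"
    \<comment> \<open>Equal source and target: no unit is moved, so all coordinates are counts and
      the \<open>Omit\<close> inequalities hold.\<close>
    using unit_masses[of q "q 0" "q 0"] q_less n
    by (simp del: ineq_lhs.simps ineq_rhs.simps) blast
  have "ineq_lhs idx n k s j z \<le> ineq_rhs n j \<longleftrightarrow> j \<noteq> Initial r" if "j \<in> facet_ineqs" for j
    using that
  proof (cases j rule: facet_ineqs_cases)
    case (Initial r')
    have "card {i. i < n \<and> q i < s * r + k} \<le> r"
      by (rule card_less_le) (rule q_upto_r)
    moreover have "Suc r' \<le> card {i. i < n \<and> q i < s * r' + k}" if "r' \<noteq> r"
      using Initial that by (intro le_card_less q_upto) auto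
    ultimately show ?thesis
      using Initial by (cases "r' = r") (simp_all add: z(2) del: ineq_lhs.simps ineq_rhs.simps)
  next
    case (Final r')
    have "card {i. i < n \<and> q i < s * r'} \<le> r'"
      by (rule card_less_le) (rule q_before)
    then show ?thesis
      using Final by (simp add: z(3) del: ineq_lhs.simps ineq_rhs.simps)
  qed (simp add: z(4) del: ineq_lhs.simps ineq_rhs.simps)
  with z(1) that show ?thesis
    by blast
qed

text \<open>The mirror image: units sit at the first positions, and the unit of block
  \<open>r\<close> is pushed one place before its block, which overfills the prefix of length
  \<open>s * r\<close> only.\<close>

lemma Final_violated_alone:
  assumes r: "0 < r" "r < n"
  obtains z :: "real ^ 'm" where "(\<Sum>j<K. z $ idx j) = real n"
    "\<And>j. j \<in> facet_ineqs \<Longrightarrow> ineq_lhs idx n k s j z \<le> ineq_rhs n j \<longleftrightarrow> j \<noteq> Final r"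
proof -
  define q where "q i = (if i = r then s * r - 1 else s * i)" for i
  have q_le: "q i \<le> s * i" for i
    by (simp add: q_def)
  have q_less: "q i < K" if "i < n" for i
    using block_le[OF that] q_le[of i] k by simp
  have q_before: "i < r'" if "q i < s * r'" "r' \<noteq> r" for i r'
  proof (cases "i = r")
    case True
    then have "s * r - 1 < s * r'"
      using that by (simp add: q_def)
    then have "s * r \<le> s * r'"
      by linarith
    then show ?thesis
      using that s True by simp
  qed (use that in \<open>simp add: q_def\<close>)
  have q_before_r: "q i < s * r" if "i < Suc r" for i
    using that s r by (auto simp: q_def)
  have q_upto: "q i < s * r' + k" if "i < Suc r'" for i r'
  proof -
    have "s * i \<le> s * r'"
      using that by simp
    with q_le[of i] k show ?thesis
      by linarith
  qed
  obtain z :: "real ^ 'm" where z: "(\<Sum>j<K. z $ idx j) = real n"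
    "\<And>r. r < n \<Longrightarrow> ineq_lhs idx n k s (Initial r) z \<le> ineq_rhs n (Initial r) \<longleftrightarrow>
      real r + 1 \<le> real (card {i. i < n \<and> q i < s * r + k})"
    "\<And>r. r < n \<Longrightarrow> ineq_lhs idx n k s (Final r) z \<le> ineq_rhs n (Final r) \<longleftrightarrow>
      real (card {i. i < n \<and> q i < s * r}) \<le> real r"
    "\<And>j. j < K \<Longrightarrow> ineq_lhs idx n k s (Omit j) z \<le> ineq_rhs n (Omit j)"
    using unit_masses[of q "q 0" "q 0"] q_less n
    by (simp del: ineq_lhs.simps ineq_rhs.simps) blast
  have "ineq_lhs idx n k s j z \<le> ineq_rhs n j \<longleftrightarrow> j \<noteq> Final r" if "j \<in> facet_ineqs" for j
    using that
  proof (cases j rule: facet_ineqs_cases)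
    case (Initial r')
    have "Suc r' \<le> card {i. i < n \<and> q i < s * r' + k}"
      using Initial by (intro le_card_less q_upto) auto
    then show ?thesis
      using Initial by (simp add: z(2) del: ineq_lhs.simps ineq_rhs.simps)
  next
    case (Final r')
    have "Suc r \<le> card {i. i < n \<and> q i < s * r}"
      using r by (intro le_card_less q_before_r) auto
    moreover have "card {i. i < n \<and> q i < s * r'} \<le> r'" if "r' \<noteq> r"
      by (rule card_less_le) (rule q_before[OF _ that])
    ultimately show ?thesis
      using Final by (cases "r' = r") (simp_all add: z(3) del: ineq_lhs.simps ineq_rhs.simps)
  qed (simp add: z(4) del: ineq_lhs.simps ineq_rhs.simps)
  with z(1) that show ?thesis
    by blast
qed

lemma Omit_violated_alone:
  assumes a: "a < K" "\<And>r. k = s + 1 \<Longrightarrow> 0 < r \<Longrightarrow> r < n \<Longrightarrow> a \<noteq> s * r"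
  obtains z :: "real ^ 'm" where "(\<Sum>j<K. z $ idx j) = real n"
    "\<And>j. j \<in> facet_ineqs \<Longrightarrow> ineq_lhs idx n k s j z \<le> ineq_rhs n j \<longleftrightarrow> j \<noteq> Omit a"
proof -
  \<comment> \<open>The mass at \<open>a\<close> is pushed below zero by moving a unit to a neighbour \<open>b\<close>. The only prefix
    sum this lowers is the one ending at \<open>a\<close>. If it ends a block \<open>r < n - 1\<close>, it has slack because
    the unit of block \<open>r + 1\<close> sits before \<open>a\<close>: this fails just in the excluded case
    \<open>k = s + 1\<close>, \<open>a = s * (r + 1)\<close>.\<close>
  define q where "q i = (if s * i = a then s * i + 1 else s * i)" for i
  define b where "b = (if Suc a < K then Suc a else a - 1)"
  \<comment> \<open>Blocks have at least two elements, so a unit that has to avoid \<open>a\<close>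
    still finds room in its block.\<close>
  have block: "s * i + 1 < s * i + k" for i
    using s k by simp
  have ab: "b < K" "b \<noteq> a"
    using a block[of 0] block_le[OF n] by (auto simp: b_def)
  have q_less: "q i < K" if "i < n" for i
    using block_le[OF that] block[of i] by (auto simp: q_def)
  have q_neq: "q i \<noteq> a" for i
    by (auto simp: q_def)
  have q_before: "i < r" if "q i < s * r" for i r
  proof -
    have "s * i \<le> q i"
      by (simp add: q_def)
    from this that have "s * i < s * r"
      by (rule le_less_trans)
    then show ?thesis
      by simp
  qed
  have q_upto: "q i < s * r + k" if "i < Suc r" for i r
  proof -
    have "s * i \<le> s * r" "q i \<le> s * i + 1"
      using that by (simp_all add: q_def)
    with block[of r] show ?thesis
      by linarith
  qed
  obtain z :: "real ^ 'm" where z: "(\<Sum>j<K. z $ idx j) = real n"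
    "\<And>r. r < n \<Longrightarrow> ineq_lhs idx n k s (Initial r) z \<le> ineq_rhs n (Initial r) \<longleftrightarrow>
      real r + 1 + of_bool (a < s * r + k) \<le>
        real (card {i. i < n \<and> q i < s * r + k}) + of_bool (b < s * r + k)"
    "\<And>r. r < n \<Longrightarrow> ineq_lhs idx n k s (Final r) z \<le> ineq_rhs n (Final r) \<longleftrightarrow>
      real (card {i. i < n \<and> q i < s * r}) + of_bool (b < s * r) \<le>
        real r + of_bool (a < s * r)"
    "\<And>j. j < K \<Longrightarrow> ineq_lhs idx n k s (Omit j) z \<le> ineq_rhs n (Omit j) \<longleftrightarrow>
      of_bool (j = a) \<le> real (card {i. i < n \<and> q i = j}) + of_bool (j = b)"
    using unit_masses[of q a b] q_less a(1) ab(1) by blast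
  have "ineq_lhs idx n k s j z \<le> ineq_rhs n j \<longleftrightarrow> j \<noteq> Omit a" if "j \<in> facet_ineqs" for j
    using that
  proof (cases j rule: facet_ineqs_cases)
    case (Initial r)
    have upto: "Suc r \<le> card {i. i < n \<and> q i < s * r + k}"
      using Initial by (intro le_card_less q_upto) auto
    show ?thesis
    proof (cases "a < s * r + k \<and> \<not> b < s * r + k")
      case True
      then have a_eq: "Suc a = s * r + k"
        by (auto simp: b_def split: if_splits)
      have "q (Suc r) = s * Suc r"
        using a(2)[of "Suc r"] a_eq Initial by (auto simp: q_def)
      then have "q i < s * r + k" if "i < Suc (Suc r)" for i
        using that q_upto k by (cases "i = Suc r") auto
      then have "Suc (Suc r) \<le> card {i. i < n \<and> q i < s * r + k}"
        using Initial by (intro le_card_less) auto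
      then show ?thesis
        using Initial True by (simp add: z(2) del: ineq_lhs.simps ineq_rhs.simps)
    next
      case False
      then show ?thesis
        using Initial upto by (auto simp add: z(2) simp del: ineq_lhs.simps ineq_rhs.simps)
    qed
  next
    case (Final r)
    have "card {i. i < n \<and> q i < s * r} \<le> r"
      by (rule card_less_le) (rule q_before)
    \<comment> \<open>\<open>b\<close> lies left of \<open>a\<close> only for
      \<open>a = K - 1\<close>, and then \<open>s * r + k \<le> K\<close> with
      \<open>k \<ge> 2\<close> keeps the prefix end from separating the two.\<close>
    moreover have "b < s * r \<Longrightarrow> a < s * r"
      using block_le[of r] block[of r] Final a(1) by (auto simp: b_def split: if_splits)
    ultimately show ?thesis
      using Final by (auto simp add: z(3) simp del: ineq_lhs.simps ineq_rhs.simps)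
  next
    case (Omit j)
    then show ?thesis
      using ab q_neq by (cases "j = a") (simp_all add: z(4) del: ineq_lhs.simps ineq_rhs.simps)
  qed
  with z(1) that show ?thesis
    by blast
qed

lemma ineq_violated_alone:
  assumes "i \<in> facet_ineqs"
  obtains z where "(\<Sum>j<K. z $ idx j) = real n"
    "\<And>j. j \<in> facet_ineqs \<Longrightarrow> ineq_lhs idx n k s j z \<le> ineq_rhs n j \<longleftrightarrow> j \<noteq> i"
  using assms
proof (cases i rule: facet_ineqs_cases)
  case (Initial r)
  then show ?thesis
    using Initial_violated_alone that by blast
next
  case (Final r)
  then show ?thesis
    using Final_violated_alone that by blast
next
  case (Omit a)
  then show ?thesis
    using Omit_violated_alone[OF Omit(2,3)] that by blast
qed

section \<open>The minimal description for all \<open>s < k\<close>\<close>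

lemma minimal_description:
  "minimal_inequality_description (P_poly idx n k s) (\<lambda>x. \<Sum>i\<in>{0..<K}. x $ idx i) (real n)
     facet_ineqs (ineq_lhs idx n k s) (ineq_rhs n)"
proof -
  obtain w :: "real ^ 'm" where w: "(\<Sum>j<K. w $ idx j) = real n"
    "\<And>i. i \<in> facet_ineqs \<Longrightarrow> ineq_lhs idx n k s i w < ineq_rhs n i"
    using strict_point by blast
  show ?thesis
    unfolding lessThan_atLeast0[symmetric]
  proof (rule minimal_inequality_descriptionI)
    show "linear (\<lambda>x::real ^ 'm. \<Sum>i<K. x $ idx i)"
      by (simp add: linear_iff sum.distrib sum_distrib_left)
    show "\<exists>z. (\<Sum>j<K. z $ idx j) = real n \<and> ineq_rhs n i < ineq_lhs idx n k s i z \<and>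
        (\<forall>j\<in>facet_ineqs - {i}. ineq_lhs idx n k s j z \<le> ineq_rhs n j)" if "i \<in> facet_ineqs" for i
      using ineq_violated_alone[OF that] that by (metis DiffE insertI1 not_le)
  qed (use finite_facet_ineqs linear_ineq_lhs P_poly_facet_ineqs w in blast)+
qed

end

theorem corollary4p24:
  fixes n k s K :: nat and idx :: "nat \<Rightarrow> 'm::finite"
  assumes "n > 0" and "k > 0" and "s > 0"
    and "K = ambient_dim n k s"
    and "bij_betw idx {0..<K} (UNIV :: 'm set)"
  shows
    "(k > s + 1 \<longrightarrow>
        minimal_inequality_description (P_poly idx n k s)
          (\<lambda>x. \<Sum>i\<in>{0..<K}. x $ idx i) (real n)
          (union_ineqs n \<union> Omit ` {0..<K})
          (ineq_lhs idx n k s) (ineq_rhs n)) \<and>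
     (k = s + 1 \<longrightarrow>
        minimal_inequality_description (P_poly idx n k s)
          (\<lambda>x. \<Sum>i\<in>{0..<K}. x $ idx i) (real n)
          (union_ineqs n \<union>
             Omit ` {a \<in> {0..<K}. \<not> (\<exists>r\<in>{1..n - 1}. a = r * (k - 1))})
          (ineq_lhs idx n k s) (ineq_rhs n))"
proof (intro conjI impI)
  \<comment> \<open>The underscore leaves \<open>s < k\<close> open; each of the two cases supplies
    it.\<close>
  note minimal = minimal_description[OF assms(1,3) _ assms(4,5)]
    and facet_ineqs_def = facet_ineqs_def[OF assms(1,3) _ assms(4,5)]
  show "minimal_inequality_description (P_poly idx n k s)
      (\<lambda>x. \<Sum>i\<in>{0..<K}. x $ idx i) (real n) (union_ineqs n \<union> Omit ` {0..<K})
      (ineq_lhs idx n k s) (ineq_rhs n)" if "k > s + 1"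
  proof -
    have "facet_ineqs n k s K = union_ineqs n \<union> Omit ` {0..<K}"
      using that by (auto simp: facet_ineqs_def)
    then show ?thesis
      using minimal that by simp
  qed
  show "minimal_inequality_description (P_poly idx n k s)
      (\<lambda>x. \<Sum>i\<in>{0..<K}. x $ idx i) (real n)
      (union_ineqs n \<union> Omit ` {a \<in> {0..<K}. \<not> (\<exists>r\<in>{1..n - 1}. a = r * (k - 1))})
      (ineq_lhs idx n k s) (ineq_rhs n)" if "k = s + 1"
  proof -
    have "facet_ineqs n k s K =
        union_ineqs n \<union> Omit ` {a \<in> {0..<K}. \<not> (\<exists>r\<in>{1..n - 1}. a = r * (k - 1))}"
      using facet_ineqs_def that by (simp add: mult.commute)
    then show ?thesis
      using minimal that by simp
  qed
qed

end
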